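(* Let $\Omega$ be a Polish metric space and let $\mathbb{M}$ be a finite Borel measure over $\Omega$. Then, for every $1 \leq p < +\infty$, $C_{b,u}(\Omega)$ is relatively $L^{p}$-dense in $L^{0}_{b}(\mathbb{M})$, i.e. the closure of $C_{b,u}(\Omega)$ in $L^{p}(\mathbb{M})$ includes $L^{0}_{b}(\mathbb{M})$.
   Context: A Polish metric space is a metric space that is complete and separable with respect to its given metric. A Borel measure over a metric space $\Omega$ is a measure defined on the Borel sigma-algebra of $\Omega$ (generated by the topology induced by the given metric). $L^{0}_{b}(\mathbb{M})$ denotes the collection of all bounded Borel functions $\Omega \to \mathbb{R}$, and $C_{b,u}(\Omega)$ denotes the collection of all bounded, uniformly continuous functions $\Omega \to \mathbb{R}$. Since $\mathbb{M}$ is finite, $C_{b,u}(\Omega) \subset L^{0}_{b}(\mathbb{M}) \subset L^{p}(\mathbb{M})$, and closures are taken with respect to the $L^{p}$-(semi)norm $f \mapsto \left(\int_{\Omega} |f|^{p} \, d\mathbb{M}\right)^{1/p}$. A subset $A_{1}$ of a topological space is relatively dense in a subset $A_{2}$ if and only if the closure of $A_{1}$ includes $A_{2}$. *)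

theory Defs
  imports "HOL-Analysis.Analysis"
begin

definition Cbu :: "('a::metric_space \<Rightarrow> real) set" where
  "Cbu = {f. bounded (range f) \<and> uniformly_continuous_on UNIV f}"

definition L0b :: "'a measure \<Rightarrow> ('a \<Rightarrow> real) set" where
  "L0b M = {f \<in> borel_measurable M. bounded (f ` space M)}"

definition Lp_space :: "real \<Rightarrow> 'a measure \<Rightarrow> ('a \<Rightarrow> real) set" where
  "Lp_space p M = {f \<in> borel_measurable M. integrable M (\<lambda>x. \<bar>f x\<bar> powr p)}"

text \<open>Only meaningful on \<open>Lp_space p M\<close>: the Bochner integral of a non-integrable function is 0.\<close>

definition Lp_seminorm :: "real \<Rightarrow> 'a measure \<Rightarrow> ('a \<Rightarrow> real) \<Rightarrow> real" where
  "Lp_seminorm p M f = (\<integral>x. \<bar>f x\<bar> powr p \<partial>M) powr (1 / p)"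

text \<open>Functions are not identified almost everywhere, so this topology is in general not Hausdorff.\<close>

definition Lp_topology :: "real \<Rightarrow> 'a measure \<Rightarrow> ('a \<Rightarrow> real) topology" where
  "Lp_topology p M = topology (\<lambda>U. U \<subseteq> Lp_space p M \<and>
     (\<forall>f\<in>U. \<exists>e>0. \<forall>g\<in>Lp_space p M. Lp_seminorm p M (\<lambda>x. g x - f x) < e \<longrightarrow> g \<in> U))"

definition relatively_dense :: "'b topology \<Rightarrow> 'b set \<Rightarrow> 'b set \<Rightarrow> bool" where
  "relatively_dense X A B \<longleftrightarrow> B \<subseteq> X closure_of A"

lemma openin_Lp_topology:
  "openin (Lp_topology p M) U \<longleftrightarrow> U \<subseteq> Lp_space p M \<and>
     (\<forall>f\<in>U. \<exists>e>0. \<forall>g\<in>Lp_space p M. Lp_seminorm p M (\<lambda>x. g x - f x) < e \<longrightarrow> g \<in> U)"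
proof -
  let ?P = "\<lambda>U. U \<subseteq> Lp_space p M \<and>
     (\<forall>f\<in>U. \<exists>e>0. \<forall>g\<in>Lp_space p M. Lp_seminorm p M (\<lambda>x. g x - f x) < e \<longrightarrow> g \<in> U)"
  have "istopology ?P"
    unfolding istopology_def
  proof (intro conjI allI impI)
    fix S T assume S: "?P S" and T: "?P T"
    then show "S \<inter> T \<subseteq> Lp_space p M" by blast
    show "\<forall>f\<in>S \<inter> T. \<exists>e>0. \<forall>g\<in>Lp_space p M.
        Lp_seminorm p M (\<lambda>x. g x - f x) < e \<longrightarrow> g \<in> S \<inter> T"
    proof
      fix f assume f: "f \<in> S \<inter> T"
      obtain d where d: "d > 0"
        "\<forall>g\<in>Lp_space p M. Lp_seminorm p M (\<lambda>x. g x - f x) < d \<longrightarrow> g \<in> S"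
        using S f by blast
      obtain e where e: "e > 0"
        "\<forall>g\<in>Lp_space p M. Lp_seminorm p M (\<lambda>x. g x - f x) < e \<longrightarrow> g \<in> T"
        using T f by blast
      show "\<exists>e>0. \<forall>g\<in>Lp_space p M. Lp_seminorm p M (\<lambda>x. g x - f x) < e \<longrightarrow> g \<in> S \<inter> T"
        using d e by (intro exI[of _ "min d e"]) auto
    qed
  next
    fix K assume "\<forall>S\<in>K. ?P S"
    then show "\<Union>K \<subseteq> Lp_space p M"
      "\<forall>f\<in>\<Union>K. \<exists>e>0. \<forall>g\<in>Lp_space p M. Lp_seminorm p M (\<lambda>x. g x - f x) < e \<longrightarrow> g \<in> \<Union>K"
      by (blast, meson UnionE UnionI)
  qed
  then show ?thesis
    by (simp add: Lp_topology_def topology_inverse')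
qed

lemma topspace_Lp_topology: "topspace (Lp_topology p M) = Lp_space p M"
proof
  show "topspace (Lp_topology p M) \<subseteq> Lp_space p M"
    using openin_Lp_topology[of p M "topspace (Lp_topology p M)"] by simp
  have "openin (Lp_topology p M) (Lp_space p M)"
    by (auto simp: openin_Lp_topology intro: exI[of _ 1])
  then show "Lp_space p M \<subseteq> topspace (Lp_topology p M)"
    by (rule openin_subset)
qed

lemma Cbu_subset_L0b:
  assumes "sets M = sets borel"
  shows "Cbu \<subseteq> L0b M"
proof
  fix f :: "'a \<Rightarrow> real" assume f: "f \<in> Cbu"
  then have "f \<in> borel_measurable borel"
    by (auto simp: Cbu_def intro!: borel_measurable_continuous_onI uniformly_continuous_imp_continuous)
  moreover have "bounded (f ` space M)"
    using f by (auto simp: Cbu_def intro: bounded_subset)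
  ultimately show "f \<in> L0b M"
    by (simp add: L0b_def measurable_cong_sets[OF assms refl])
qed

lemma L0b_subset_Lp_space:
  assumes "finite_measure M" "1 \<le> p"
  shows "L0b M \<subseteq> Lp_space p M"
proof
  fix f assume f: "f \<in> L0b M"
  then obtain B where B: "\<forall>x\<in>space M. \<bar>f x\<bar> \<le> B"
    by (auto simp: L0b_def bounded_iff)
  have "AE x in M. norm (\<bar>f x\<bar> powr p) \<le> B powr p"
    using B assms(2) by (intro AE_I2) (auto intro!: powr_mono2)
  moreover have [measurable]: "f \<in> borel_measurable M"
    using f by (simp add: L0b_def)
  ultimately have "integrable M (\<lambda>x. \<bar>f x\<bar> powr p)"
    by (intro finite_measure.integrable_const_bound[OF assms(1)]) simp_all
  then show "f \<in> Lp_space p M"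
    by (simp add: Lp_space_def)
qed

end

theory Submission
  imports Defs
begin

text \<open>
  No approximation is carried out in \<open>L\<^sup>p\<close> itself. For \<open>p = 1\<close> the functions approximable by
  bounded uniformly continuous ones form a closed linear subspace, so it suffices to reach
  indicators of Borel sets (\<open>L1_approx_Cbu\<close>). On a Polish space a finite measure is inner regular,
  so a Borel set may be replaced by a compact one \<open>K\<close> (\<open>L1_approx_indicator\<close>); and the indicator of
  \<open>K\<close> is the pointwise limit of the Lipschitz functions \<open>1 - n d(x, K)\<close>, cut off at \<open>0\<close>
  (\<open>L1_approx_indicator_compact\<close>).

  For general \<open>p\<close>, take \<open>\<bar>f\<bar> \<le> B\<close> and clamp its \<open>L\<^sup>1\<close> approximant \<open>g\<close> to \<open>[-B, B]\<close>. The
  clamped function \<open>h\<close> is still uniformly continuous and no farther from \<open>f\<close>, while now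
  \<open>\<bar>h - f\<bar> \<le> 2 B\<close>, so that \<open>\<bar>h - f\<bar> powr p \<le> (2 B) powr (p - 1) * \<bar>h - f\<bar>\<close>: smallness in
  \<open>L\<^sup>1\<close> forces smallness in \<open>L\<^sup>p\<close> (\<open>Lp_approx_Cbu\<close>).
\<close>

section \<open>Bounded uniformly continuous functions\<close>

lemma clamp_in_Cbu:
  fixes g :: "'a::metric_space \<Rightarrow> real"
  assumes "uniformly_continuous_on UNIV g"
  shows "(\<lambda>x. max a (min b (g x))) \<in> Cbu"
proof -
  have "bounded (range (\<lambda>x. max a (min b (g x))))"
    by (rule boundedI[where B = "\<bar>a\<bar> + \<bar>b\<bar>"]) (auto simp: max_def min_def)
  moreover have "uniformly_continuous_on UNIV (\<lambda>x. max a (min b (g x)))"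
    unfolding uniformly_continuous_on_def
  proof (intro allI impI)
    fix e :: real assume "e > 0"
    then obtain d where "d > 0" and d: "\<And>x y. dist y x < d \<Longrightarrow> dist (g y) (g x) < e"
      using assms unfolding uniformly_continuous_on_def by blast
    have "dist (max a (min b s)) (max a (min b t)) \<le> dist s t" for s t
      by (auto simp: dist_real_def max_def min_def)
    with \<open>d > 0\<close> d
    show "\<exists>d>0. \<forall>x\<in>UNIV. \<forall>y\<in>UNIV. dist y x < d \<longrightarrow>
        dist (max a (min b (g y))) (max a (min b (g x))) < e"
      by (meson le_less_trans)
  qed
  ultimately show ?thesis
    by (simp add: Cbu_def)
qed

lemma const_in_Cbu: "(\<lambda>x. c) \<in> Cbu"
  by (auto simp: Cbu_def intro: uniformly_continuous_on_const)

lemma add_in_Cbu: "f \<in> Cbu \<Longrightarrow> g \<in> Cbu \<Longrightarrow> (\<lambda>x. f x + g x) \<in> Cbu"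
  by (auto simp: Cbu_def intro!: bounded_plus_comp uniformly_continuous_on_add)

lemma cmult_in_Cbu: "f \<in> Cbu \<Longrightarrow> (\<lambda>x. c * f x) \<in> Cbu"
  using bounded_scaling[of "range f" c]
  by (auto simp: Cbu_def image_image
      intro!: bounded_linear.uniformly_continuous_on[OF bounded_linear_mult_right])

lemma integrable_Cbu:
  assumes "finite_measure M" and "sets M = sets borel" and "f \<in> Cbu"
  shows "integrable M f"
proof -
  have "f \<in> L0b M"
    using Cbu_subset_L0b[OF assms(2)] assms(3) by blast
  then show ?thesis
    using L0b_subset_Lp_space[OF assms(1), of 1]
    by (auto simp: Lp_space_def integrable_abs_iff)
qed

section \<open>Approximation in the mean\<close>

text \<open>
  The Lipschitz functions \<open>max 0 (1 - n d(x, K))\<close> equal \<open>1\<close> on \<open>K\<close>, and off \<open>K\<close> they vanish as soon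
  as \<open>n \<ge> 1 / d(x, K)\<close>; dominated convergence does the rest.
\<close>

lemma L1_approx_indicator_compact:
  fixes M :: "'a::metric_space measure"
  assumes "finite_measure M" and sets: "sets M = sets borel"
    and "compact K" and "e > 0"
  shows "\<exists>g\<in>Cbu. (\<integral>x. \<bar>indicator K x - g x\<bar> \<partial>M) < e"
proof (cases "K = {}")
  \<comment> \<open>The distance to the empty set is \<open>0\<close> by convention, so this case needs its own approximant.\<close>
  case True
  then show ?thesis
    using \<open>e > 0\<close> by (intro bexI[of _ "\<lambda>_. 0"]) (auto intro: const_in_Cbu)
next
  case False
  interpret finite_measure M by fact
  have "closed K"
    using assms by (simp add: compact_imp_closed)
  \<comment> \<open>The upper bound \<open>1\<close> never cuts anything off; it puts \<open>g\<close> into the form of a clamped function.\<close>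
  define g where "g n x = max 0 (min 1 (1 - real n * infdist x K))" for n x
  have g_Cbu: "g n \<in> Cbu" for n
  proof -
    have "uniformly_continuous_on UNIV (\<lambda>x. infdist x K)"
      unfolding uniformly_continuous_on_def
      by (metis dist_real_def infdist_triangle_abs le_less_trans)
    then have "uniformly_continuous_on UNIV (\<lambda>x. 1 - real n * infdist x K)"
      by (intro uniformly_continuous_on_diff uniformly_continuous_on_const
          bounded_linear.uniformly_continuous_on[OF bounded_linear_mult_right])
    then show ?thesis
      unfolding g_def by (rule clamp_in_Cbu)
  qed
  have K [measurable]: "K \<in> sets M"
    using \<open>closed K\<close> by (simp add: sets)
  have [measurable]: "g n \<in> borel_measurable M" for n
    using integrable_Cbu[OF assms(1) sets g_Cbu] by simp
  have lim: "(\<lambda>n. \<bar>indicator K x - g n x\<bar>) \<longlonglongrightarrow> 0" for x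
  proof (cases "x \<in> K")
    case True
    then show ?thesis by (simp add: g_def)
  next
    case x: False
    with False \<open>closed K\<close> have pos: "infdist x K > 0"
      by (simp add: infdist_pos_not_in_closed)
    then obtain N where "1 < real N * infdist x K"
      using reals_Archimedean3 by blast
    then have "1 \<le> real n * infdist x K" if "n \<ge> N" for n
      using that pos by (smt (verit) mult_right_mono of_nat_mono)
    then have "g n x = 0" if "n \<ge> N" for n
      using that by (fastforce simp: g_def)
    then have "\<forall>\<^sub>F n in sequentially. \<bar>indicator K x - g n x\<bar> = 0"
      using x by (intro eventually_sequentiallyI[of N]) simp
    then show ?thesis by (rule tendsto_eventually)
  qed
  have "(\<lambda>n. \<integral>x. \<bar>indicator K x - g n x\<bar> \<partial>M) \<longlonglongrightarrow> (\<integral>x. 0 \<partial>M)"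
  proof (rule integral_dominated_convergence[where w = "\<lambda>_. 1"])
    show "AE x in M. norm \<bar>indicator K x - g n x\<bar> \<le> 1" for n
      by (auto simp: g_def indicator_def infdist_nonneg)
  qed (use lim in auto)
  then have "\<forall>\<^sub>F n in sequentially. (\<integral>x. \<bar>indicator K x - g n x\<bar> \<partial>M) < e"
    using \<open>e > 0\<close> by (simp add: order_tendstoD)
  then show ?thesis
    using g_Cbu by (auto simp: eventually_sequentially)
qed

text \<open>
  This is where completeness and separability enter: by inner regularity \<open>A\<close> contains a compact \<open>K\<close>
  of almost full measure, and \<open>M (A - K)\<close> is the mean distance between the two indicators.
\<close>

lemma L1_approx_indicator:
  fixes M :: "'a::polish_space measure"
  assumes "finite_measure M" and sets: "sets M = sets borel"
    and A: "A \<in> sets M" and "e > 0"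
  shows "\<exists>g\<in>Cbu. (\<integral>x. \<bar>indicator A x - g x\<bar> \<partial>M) < e"
proof -
  interpret finite_measure M by fact
  have "\<exists>K. K \<subseteq> A \<and> compact K \<and> measure M A < measure M K + e / 2"
  proof (rule ccontr)
    assume "\<not> ?thesis"
    then have le: "measure M K \<le> measure M A - e / 2" if "K \<subseteq> A" "compact K" for K
      using that by (force simp: not_less)
    then have "measure M A - e / 2 \<ge> 0"
      using le[of "{}"] by simp
    have "emeasure M A = (SUP K \<in> {K. K \<subseteq> A \<and> compact K}. emeasure M K)"
      using A by (intro inner_regular) (auto simp: sets)
    also have "\<dots> \<le> ennreal (measure M A - e / 2)"
      using le by (intro SUP_least) (auto simp: emeasure_eq_measure ennreal_leI)
    finally show False
      using \<open>measure M A - e / 2 \<ge> 0\<close> \<open>e > 0\<close> by (simp add: emeasure_eq_measure)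
  qed
  then obtain K where K: "K \<subseteq> A" "compact K" "measure M A < measure M K + e / 2"
    by blast
  obtain g where g: "g \<in> Cbu" "(\<integral>x. \<bar>indicator K x - g x\<bar> \<partial>M) < e / 2"
    using L1_approx_indicator_compact[OF assms(1) sets K(2), of "e / 2"] \<open>e > 0\<close> by auto
  have Ks [measurable]: "K \<in> sets M"
    using K(2) by (simp add: sets compact_imp_closed)
  note [measurable] = A
  have int [simp]: "integrable M g"
    by (rule integrable_Cbu[OF assms(1) sets g(1)])
  have ind [simp]: "integrable M (indicator B :: 'a \<Rightarrow> real)" if "B \<in> sets M" for B
    using that by (simp add: integrable_indicator_iff less_top[symmetric])
  have "(\<integral>x. \<bar>indicator A x - g x\<bar> \<partial>M)
      \<le> (\<integral>x. (indicator A x - indicator K x) + \<bar>indicator K x - g x\<bar> \<partial>M)"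
  proof (rule integral_mono)
    show "\<bar>indicator A x - g x\<bar> \<le> (indicator A x - indicator K x) + \<bar>indicator K x - g x\<bar>" for x
      using K(1) by (auto simp: indicator_def)
  qed (use A Ks in \<open>auto intro!: integrable_add integrable_diff integrable_abs\<close>)
  also have "\<dots> = (measure M A - measure M K) + (\<integral>x. \<bar>indicator K x - g x\<bar> \<partial>M)"
    using A Ks by (simp add: sets_eq_imp_space_eq[OF sets])
  also have "\<dots> < e"
    using K(3) g(2) by linarith
  finally show ?thesis
    using g(1) by blast
qed

text \<open>
  The approximable functions form a closed linear subspace of \<open>L\<^sup>1\<close>, and indicators of Borel sets
  span a dense one.
\<close>

lemma L1_approx_Cbu:
  fixes M :: "'a::polish_space measure" and f :: "'a \<Rightarrow> real"
  assumes "finite_measure M" and sets: "sets M = sets borel"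
    and "integrable M f" and "e > 0"
  shows "\<exists>g\<in>Cbu. (\<integral>x. \<bar>f x - g x\<bar> \<partial>M) < e"
  using assms(3,4)
proof (induction arbitrary: e rule: integrable_induct)
  case (base A c)
  have pos: "e / (\<bar>c\<bar> + 1) > 0"
    using base by simp
  obtain g where g: "g \<in> Cbu" "(\<integral>x. \<bar>indicator A x - g x\<bar> \<partial>M) < e / (\<bar>c\<bar> + 1)"
    using L1_approx_indicator[OF assms(1) sets base(1) pos] by blast
  have "(\<integral>x. \<bar>indicator A x *\<^sub>R c - c * g x\<bar> \<partial>M) = \<bar>c\<bar> * (\<integral>x. \<bar>indicator A x - g x\<bar> \<partial>M)"
    unfolding integral_mult_right_zero[symmetric] abs_mult[symmetric]
    by (simp add: algebra_simps)
  also have "\<dots> \<le> (\<bar>c\<bar> + 1) * (\<integral>x. \<bar>indicator A x - g x\<bar> \<partial>M)"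
    by (intro mult_right_mono) auto
  also have "\<dots> < e"
    using g(2) by (simp add: field_simps add_pos_nonneg)
  finally show ?case
    using cmult_in_Cbu[OF g(1)] by (intro bexI)
next
  case (add u v)
  have half: "e / 2 > 0"
    using add.prems by simp
  obtain g where g: "g \<in> Cbu" "(\<integral>x. \<bar>u x - g x\<bar> \<partial>M) < e / 2"
    using add.IH(1)[OF half] by blast
  obtain h where h: "h \<in> Cbu" "(\<integral>x. \<bar>v x - h x\<bar> \<partial>M) < e / 2"
    using add.IH(2)[OF half] by blast
  note [simp] = add.hyps integrable_Cbu[OF assms(1) sets g(1)] integrable_Cbu[OF assms(1) sets h(1)]
  have "(\<integral>x. \<bar>(u x + v x) - (g x + h x)\<bar> \<partial>M) \<le> (\<integral>x. \<bar>u x - g x\<bar> + \<bar>v x - h x\<bar> \<partial>M)"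
    by (intro integral_mono) auto
  also have "\<dots> < e"
    using g(2) h(2) by simp
  finally show ?case
    using add_in_Cbu[OF g(1) h(1)] by (intro bexI)
next
  case (lim f s)
  have half: "e / 2 > 0"
    using lim.prems by simp
  have [measurable]: "f \<in> borel_measurable M" "s i \<in> borel_measurable M" for i
    using lim.hyps by auto
  have "(\<lambda>i. \<integral>x. \<bar>f x - s i x\<bar> \<partial>M) \<longlonglongrightarrow> (\<integral>x. 0 \<partial>M)"
    \<comment> \<open>The approximating simple functions satisfy \<open>\<bar>s i x\<bar> \<le> 2 * \<bar>f x\<bar>\<close>.\<close>
  proof (rule integral_dominated_convergence[where w = "\<lambda>x. 3 * \<bar>f x\<bar>"])
    show "AE x in M. (\<lambda>i. \<bar>f x - s i x\<bar>) \<longlonglongrightarrow> 0"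
      using lim.hyps(2)
      by (intro AE_I2) (auto intro!: tendsto_eq_intros)
    show "AE x in M. norm \<bar>f x - s i x\<bar> \<le> 3 * \<bar>f x\<bar>" for i
      using lim.hyps(3) by (intro AE_I2) (smt (verit) real_norm_def)
  qed (use lim.hyps in auto)
  then have "\<forall>\<^sub>F i in sequentially. (\<integral>x. \<bar>f x - s i x\<bar> \<partial>M) < e / 2"
    using half by (intro order_tendstoD(2)[where y = 0]) simp_all
  then obtain i where i: "(\<integral>x. \<bar>f x - s i x\<bar> \<partial>M) < e / 2"
    by (auto simp: eventually_sequentially)
  obtain g where g: "g \<in> Cbu" "(\<integral>x. \<bar>s i x - g x\<bar> \<partial>M) < e / 2"
    using lim.IH[OF half] by blast
  note [simp] = lim.hyps integrable_Cbu[OF assms(1) sets g(1)]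
  have "(\<integral>x. \<bar>f x - g x\<bar> \<partial>M) \<le> (\<integral>x. \<bar>f x - s i x\<bar> + \<bar>s i x - g x\<bar> \<partial>M)"
    by (intro integral_mono) auto
  also have "\<dots> < e"
    using i g(2) by simp
  finally show ?case
    using g(1) by blast
qed

section \<open>From mean convergence to higher exponents\<close>

text \<open>
  On functions with values in \<open>[-B, B]\<close>, \<open>L\<^sup>1\<close>-smallness controls the \<open>L\<^sup>p\<close>-seminorm; clamping
  the \<open>L\<^sup>1\<close> approximant brings it into that range without moving it away from \<open>f\<close>.
\<close>

lemma Lp_approx_Cbu:
  fixes M :: "'a::polish_space measure"
  assumes fin: "finite_measure M" and sets: "sets M = sets borel" and "1 \<le> p"
    and f: "f \<in> L0b M" and "e > 0"
  shows "\<exists>h\<in>Cbu. Lp_seminorm p M (\<lambda>x. h x - f x) < e"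
proof -
  obtain B where "B > 0" and B: "\<And>x. x \<in> space M \<Longrightarrow> \<bar>f x\<bar> \<le> B"
    using f unfolding L0b_def bounded_pos by auto
  have int_f: "integrable M f"
    using L0b_subset_Lp_space[OF fin, of 1] f by (auto simp: Lp_space_def integrable_abs_iff)
  define C where "C = (2 * B) powr (p - 1)"
  have "C > 0"
    using \<open>B > 0\<close> by (simp add: C_def)
  \<comment> \<open>Chosen so that the \<open>p\<close>-th power integral, at most \<open>C\<close> times the \<open>L\<^sup>1\<close> distance, is below \<open>e powr p\<close>.\<close>
  have "e powr p / C > 0"
    using \<open>e > 0\<close> \<open>C > 0\<close> by simp
  then obtain g where g: "g \<in> Cbu" "(\<integral>x. \<bar>f x - g x\<bar> \<partial>M) < e powr p / C"
    using L1_approx_Cbu[OF fin sets int_f] by blast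
  define h where "h x = max (- B) (min B (g x))" for x
  have h: "h \<in> Cbu"
    unfolding h_def using g(1) by (intro clamp_in_Cbu) (simp add: Cbu_def)
  have int_g: "integrable M g"
    by (rule integrable_Cbu[OF fin sets g(1)])
  have bound: "\<bar>h x - f x\<bar> powr p \<le> C * \<bar>f x - g x\<bar>" if "x \<in> space M" for x
  proof -
    have near: "\<bar>h x - f x\<bar> \<le> \<bar>f x - g x\<bar>" and range: "\<bar>h x - f x\<bar> \<le> 2 * B"
      using B[OF that] by (auto simp: h_def max_def min_def)
    have "\<bar>h x - f x\<bar> powr p = \<bar>h x - f x\<bar> powr (p - 1) * \<bar>h x - f x\<bar>"
      by (simp add: powr_mult_base[symmetric] powr_diff)
    also have "\<dots> \<le> C * \<bar>f x - g x\<bar>"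
      unfolding C_def using near range \<open>1 \<le> p\<close>
      by (intro mult_mono powr_mono2) auto
    finally show ?thesis .
  qed
  have "(\<integral>x. \<bar>h x - f x\<bar> powr p \<partial>M) \<le> (\<integral>x. C * \<bar>f x - g x\<bar> \<partial>M)"
    using bound int_f int_g \<open>C > 0\<close> by (intro integral_mono') auto
  also have "\<dots> < e powr p"
    using g(2) \<open>C > 0\<close> by (simp add: field_simps)
  finally have "Lp_seminorm p M (\<lambda>x. h x - f x) < (e powr p) powr (1 / p)"
    unfolding Lp_seminorm_def using \<open>1 \<le> p\<close>
    by (intro powr_less_mono2) auto
  also have "\<dots> = e"
    using \<open>1 \<le> p\<close> \<open>e > 0\<close> by (simp add: powr_powr)
  finally show ?thesis
    using h by blast
qed

theorem theorem3:
  fixes M :: "'a::polish_space measure" and p :: real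
  assumes "finite_measure M"
    and "sets M = sets borel"
    and "1 \<le> p"
  shows "relatively_dense (Lp_topology p M) Cbu (L0b M)"
  unfolding relatively_dense_def
proof
  have L0b: "L0b M \<subseteq> Lp_space p M"
    by (rule L0b_subset_Lp_space[OF assms(1,3)])
  then have Cbu: "Cbu \<subseteq> Lp_space p M"
    using Cbu_subset_L0b[OF assms(2)] by blast
  fix f assume f: "f \<in> L0b M"
  show "f \<in> Lp_topology p M closure_of Cbu"
    unfolding in_closure_of topspace_Lp_topology
  proof (intro conjI allI impI)
    show "f \<in> Lp_space p M"
      using f L0b by blast
    fix U assume "f \<in> U \<and> openin (Lp_topology p M) U"
    then obtain e where "e > 0"
      and e: "\<And>g. g \<in> Lp_space p M \<Longrightarrow> Lp_seminorm p M (\<lambda>x. g x - f x) < e \<Longrightarrow> g \<in> U"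
      unfolding openin_Lp_topology by blast
    show "\<exists>g. g \<in> Cbu \<and> g \<in> U"
      using Lp_approx_Cbu[OF assms f \<open>e > 0\<close>] Cbu e by blast
  qed
qed

end
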